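(* Let $k \geq 17$ be an integer and let $\Sigma$ be an alphabet with $k$ letters. Then there is no extremal square-free word over $\Sigma$. That is, for every nonempty-or-empty finite square-free word $W$ over $\Sigma$, there exist words $W_1, W_2$ over $\Sigma$ with $W = W_1W_2$ and a letter $x \in \Sigma$ such that $W_1 x W_2$ is square-free.
   Context: A word is a finite sequence of letters over a finite alphabet; a factor of a word is a subword consisting of consecutive letters. A square is a nonempty word of the form $XX$. A word is square-free if it has no square as a factor. An extension of a finite word $W$ is a word $W_1 x W_2$ where $x$ is a single letter and $W_1, W_2$ are (possibly empty) words with $W = W_1W_2$. An extremal square-free word is a square-free word none of whose extensions is square-free. *)

theory Defs
  imports Main "HOL-Library.Sublist"
begin

definition square :: "'a list \<Rightarrow> bool" where
  "square U \<longleftrightarrow> (\<exists>X. X \<noteq> [] \<and> U = X @ X)"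

definition square_free :: "'a list \<Rightarrow> bool" where
  "square_free W \<longleftrightarrow> \<not> (\<exists>U. sublist U W \<and> square U)"

definition extensions :: "'a set \<Rightarrow> 'a list \<Rightarrow> 'a list set" where
  "extensions \<Sigma> W = {W\<^sub>1 @ [x] @ W\<^sub>2 | W\<^sub>1 x W\<^sub>2. x \<in> \<Sigma> \<and> W = W\<^sub>1 @ W\<^sub>2}"

definition extremal_square_free :: "'a set \<Rightarrow> 'a list \<Rightarrow> bool" where
  "extremal_square_free \<Sigma> W \<longleftrightarrow>
     W \<in> lists \<Sigma> \<and> square_free W \<and> (\<forall>V \<in> extensions \<Sigma> W. \<not> square_free V)"

end

theory Submission
  imports Defs Complex_Main
begin

text \<open>If every insertion creates a square, then each of the \<open>n + 1\<close> gaps carries at least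
  \<open>k\<close> such squares, one per letter, and the letter is determined by the half-length
  \<open>q + 1\<close> and by the half that contains it. By reversal consider squares with the new letter
  in the left half. Such a square leaves in \<open>W\<close> an interval of \<open>q\<close> positions whose letters
  recur after \<open>q\<close> or \<open>q + 1\<close> steps. Square-freeness makes these intervals disjoint for equal
  \<open>q\<close>, and bounds their overlap by \<open>3 |q - q'|\<close> if \<open>|q - q'| \<ge> 2\<close>. Hence, packing the
  intervals into \<open>n\<close> positions, a single \<open>q > 0\<close> occurs at most \<open>n / q\<close> times, and each
  parity class of a window \<open>[Q, Q + s)\<close> with \<open>Q \<ge> 4 s\<close> at most \<open>n / (Q - 3 s)\<close> times.
  With single values for \<open>q < 8\<close> and dyadic blocks of four windows beyond, there are fewer
  than \<open>(17 / 2) (n + 1)\<close> squares on either side.\<close>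

section \<open>Squares in index form and their reversal\<close>

definition square_at :: "'a list \<Rightarrow> nat \<Rightarrow> nat \<Rightarrow> bool" where
  "square_at W s p \<longleftrightarrow>
     0 < p \<and> s + 2 * p \<le> length W \<and> (\<forall>t. s \<le> t \<and> t < s + p \<longrightarrow> W ! t = W ! (t + p))"

lemma square_free_iff_square_at: "square_free W \<longleftrightarrow> (\<forall>s p. \<not> square_at W s p)"
proof
  assume sf: "square_free W"
  show "\<forall>s p. \<not> square_at W s p"
  proof (intro allI notI)
    fix s p assume sq: "square_at W s p"
    define X where "X = take p (drop s W)"
    have len: "s + 2 * p \<le> length W" and p: "0 < p"
      using sq by (auto simp: square_at_def)
    have "take p (drop (s + p) W) = X"
    proof (rule nth_equalityI)
      show "length (take p (drop (s + p) W)) = length X"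
        using len by (simp add: X_def)
      fix j assume "j < length (take p (drop (s + p) W))"
      then have j: "j < p" by simp
      have "W ! (s + j) = W ! (s + j + p)"
        using sq j by (simp add: square_at_def)
      then show "take p (drop (s + p) W) ! j = X ! j"
        using j len by (simp add: X_def ac_simps)
    qed
    then have "take (p + p) (drop s W) = X @ X"
      by (simp only: take_add drop_drop X_def add.commute)
    moreover have "X \<noteq> []" using len p by (simp add: X_def)
    ultimately have "square (take (p + p) (drop s W))"
      unfolding square_def by blast
    moreover have "sublist (take (p + p) (drop s W)) W"
      by (meson sublist_drop sublist_order.order_trans sublist_take)
    ultimately show False using sf by (auto simp: square_free_def)
  qed
next
  assume no: "\<forall>s p. \<not> square_at W s p"
  show "square_free W"
    unfolding square_free_def
  proof
    assume "\<exists>U. sublist U W \<and> square U"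
    then obtain X P S where X: "X \<noteq> []" and W: "W = P @ (X @ X) @ S"
      by (auto simp: square_def sublist_def)
    have "square_at W (length P) (length X)"
      unfolding square_at_def
    proof (intro conjI allI impI)
      show "0 < length X" using X by simp
      show "length P + 2 * length X \<le> length W" by (simp add: W)
      fix t assume "length P \<le> t \<and> t < length P + length X"
      then show "W ! t = W ! (t + length X)"
        by (auto simp: W nth_append)
    qed
    with no show False by blast
  qed
qed

lemma square_at_rev:
  assumes "square_at W s p"
  shows "square_at (rev W) (length W - s - 2 * p) p"
  unfolding square_at_def
proof (intro conjI allI impI)
  have p: "0 < p" and len: "s + 2 * p \<le> length W"
    and eq: "\<And>t. s \<le> t \<Longrightarrow> t < s + p \<Longrightarrow> W ! t = W ! (t + p)"
    using assms by (auto simp: square_at_def)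
  show "0 < p" by (rule p)
  show "length W - s - 2 * p + 2 * p \<le> length (rev W)" using len by simp
  fix t assume t: "length W - s - 2 * p \<le> t \<and> t < length W - s - 2 * p + p"
  \<comment> \<open>Reversal exchanges the halves: \<open>t + p\<close> is mirrored to
    \<open>u\<close>, and \<open>t\<close> to \<open>u + p\<close>.\<close>
  define u where "u = length W - Suc (t + p)"
  have "rev W ! (t + p) = W ! u"
    using t len by (subst rev_nth) (auto simp: u_def)
  moreover have "length W - Suc t = u + p" using t len by (auto simp: u_def)
  then have "rev W ! t = W ! (u + p)"
    using t len p by (subst rev_nth) auto
  moreover have "W ! u = W ! (u + p)"
    by (rule eq) (use t len in \<open>auto simp: u_def\<close>)
  ultimately show "rev W ! t = rev W ! (t + p)" by simp
qed

lemma square_free_rev: "square_free W \<Longrightarrow> square_free (rev W)"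
  using square_at_rev[of "rev W"] unfolding square_free_iff_square_at rev_rev_ident by blast

section \<open>Squares created by an insertion\<close>

text \<open>Inserting the letter \<^term>\<open>W ! (i + q)\<close> at gap \<^term>\<open>i\<close> of \<^term>\<open>W\<close> completes a
  square of half-length \<^term>\<open>q + 1\<close> that starts at \<^term>\<open>l\<close> and contains the new letter in
  its left half.\<close>

definition near_square :: "'a list \<Rightarrow> nat \<Rightarrow> nat \<Rightarrow> nat \<Rightarrow> bool" where
  "near_square W l i q \<longleftrightarrow>
     l \<le> i \<and> i \<le> l + q \<and> l + 2 * q + 1 \<le> length W \<and>
     (\<forall>t. l \<le> t \<and> t < i \<longrightarrow> W ! t = W ! (t + q)) \<and>
     (\<forall>t. i \<le> t \<and> t < l + q \<longrightarrow> W ! t = W ! (t + q + 1))"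

lemma nth_insertion:
  assumes "i \<le> length W" "m \<le> length W"
  shows "(take i W @ [x] @ drop i W) ! m = (if m < i then W ! m else if m = i then x else W ! (m - 1))"
  using assms by (cases "m < i") (simp_all add: nth_append nth_Cons' min_absorb2)

text \<open>When the new letter is deleted, a position before the gap keeps its index while its
  partner drops by one, so the shift becomes \<open>p - 1\<close>. After the gap both drop and the
  shift stays \<open>p\<close>.\<close>

lemma square_at_insertion_left:
  assumes i: "i \<le> length W" and sq: "square_at (take i W @ [x] @ drop i W) s p"
    and si: "s \<le> i" "i < s + p"
  shows "near_square W s i (p - 1) \<and> W ! (i + (p - 1)) = x"
proof -
  let ?V = "take i W @ [x] @ drop i W"
  obtain q where p: "p = Suc q" using sq by (cases p) (auto simp: square_at_def)
  have len: "s + 2 * q + 1 \<le> length W"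
    using sq i by (simp add: square_at_def p)
  have eq: "?V ! t = ?V ! (t + Suc q)" if "s \<le> t" "t < s + Suc q" for t
    using sq that unfolding square_at_def p by blast
  note V = nth_insertion[OF i]
  have "W ! t = W ! (t + q)" if "s \<le> t" "t < i" for t
    using eq[of t] V[of t x] V[of "t + Suc q" x] that si len p by auto
  moreover have "W ! t = W ! (t + q + 1)" if "i \<le> t" "t < s + q" for t
    using eq[of "Suc t"] V[of "Suc t" x] V[of "Suc t + Suc q" x] that si len p by auto
  moreover have "W ! (i + q) = x"
    using eq[of i] V[of i x] V[of "i + Suc q" x] si len p by auto
  ultimately show ?thesis
    using si len by (auto simp: near_square_def p)
qed

text \<open>A square avoiding the new letter would already lie in \<open>W\<close>. A new letter in
  the right half moves to the left half under reversal, at gap \<open>length W - i\<close>.\<close>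

lemma not_square_free_insertion:
  assumes sf: "square_free W" and i: "i \<le> length W"
    and nsf: "\<not> square_free (take i W @ [x] @ drop i W)"
  shows "(\<exists>l q. near_square W l i q \<and> W ! (i + q) = x) \<or>
    (\<exists>l q. near_square (rev W) l (length W - i) q \<and> rev W ! (length W - i + q) = x)"
proof -
  let ?V = "take i W @ [x] @ drop i W"
  let ?n = "length W"
  obtain s p where sq: "square_at ?V s p"
    using nsf square_free_iff_square_at by blast
  have p: "0 < p" and len: "s + 2 * p \<le> ?n + 1"
    and eq: "\<And>t. s \<le> t \<Longrightarrow> t < s + p \<Longrightarrow> ?V ! t = ?V ! (t + p)"
    using sq i by (simp_all add: square_at_def)
  note V = nth_insertion[OF i]
  consider "i < s" | "s \<le> i" "i < s + p" | "s + p \<le> i" "i < s + 2 * p" | "s + 2 * p \<le> i"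
    by linarith
  then show ?thesis
  proof cases
    case 1
    have "W ! t = W ! (t + p)" if "s - 1 \<le> t" "t < s - 1 + p" for t
    proof -
      have t: "i \<le> t" "Suc t + p \<le> ?n" using that 1 len p by auto
      have "?V ! Suc t = W ! t" "?V ! (Suc t + p) = W ! (t + p)"
        using V[of "Suc t" x] V[of "Suc t + p" x] t by simp_all
      moreover have "?V ! Suc t = ?V ! (Suc t + p)" using that 1 by (intro eq) auto
      ultimately show ?thesis by simp
    qed
    then have "square_at W (s - 1) p"
      using p len 1 by (auto simp: square_at_def)
    then show ?thesis using sf square_free_iff_square_at by blast
  next
    case 2
    then show ?thesis using square_at_insertion_left[OF i sq] by blast
  next
    case 3
    have "rev ?V = take (?n - i) (rev W) @ [x] @ drop (?n - i) (rev W)"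
      using i by (simp add: rev_take rev_drop)
    moreover have "length ?V = ?n + 1" using i by simp
    ultimately have "square_at (take (?n - i) (rev W) @ [x] @ drop (?n - i) (rev W))
        (?n + 1 - s - 2 * p) p"
      using square_at_rev[OF sq] by metis
    from square_at_insertion_left[OF _ this]
    have "near_square (rev W) (?n + 1 - s - 2 * p) (?n - i) (p - 1) \<and>
        rev W ! (?n - i + (p - 1)) = x"
      using 3 len i by simp
    then show ?thesis by blast
  next
    case 4
    have "W ! t = W ! (t + p)" if "s \<le> t" "t < s + p" for t
      using eq[of t] V[of t x] V[of "t + p" x] that 4 len i by auto
    then have "square_at W s p"
      using p 4 i by (auto simp: square_at_def)
    then show ?thesis using sf square_free_iff_square_at by blast
  qed
qed

section \<open>Overlaps of near squares\<close>

text \<open>Both \<open>W ! (t + d)\<close> and \<open>W ! (t + d')\<close> equal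
  \<open>W ! t\<close>, so the run moved by \<open>d\<close> has period \<open>d' - d\<close>; a run
  of that length yields a square.\<close>

lemma common_run_short:
  assumes sf: "square_free W" and d: "d < d'" and len: "v + d' \<le> length W"
    and m: "\<And>t. u \<le> t \<Longrightarrow> t < v \<Longrightarrow> W ! t = W ! (t + d)"
      "\<And>t. u \<le> t \<Longrightarrow> t < v \<Longrightarrow> W ! t = W ! (t + d')"
  shows "v < u + (d' - d)"
proof (rule ccontr)
  assume neg: "\<not> v < u + (d' - d)"
  have "square_at W (u + d) (d' - d)"
    unfolding square_at_def
  proof (intro conjI allI impI)
    show "0 < d' - d" "u + d + 2 * (d' - d) \<le> length W" using d neg len by auto
    fix t assume t: "u + d \<le> t \<and> t < u + d + (d' - d)"
    have "u \<le> t - d" "t - d < v" using t neg d by auto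
    then have "W ! (t - d + d) = W ! (t - d + d')"
      using m by metis
    moreover have "t - d + d = t" "t - d + d' = t + (d' - d)" using t d by auto
    ultimately show "W ! t = W ! (t + (d' - d))" by metis
  qed
  then show False using sf square_free_iff_square_at by blast
qed

lemma near_square_gap_less:
  assumes sf: "square_free W" and q: "0 < q" and e: "near_square W l i q"
  shows "i < l + q"
proof (rule ccontr)
  assume "\<not> i < l + q"
  then have "square_at W l q" using e q by (auto simp: square_at_def near_square_def)
  then show False using sf square_free_iff_square_at by blast
qed

lemma near_square_same_length_disjoint:
  assumes sf: "square_free W" and q: "0 < q"
    and e: "near_square W l i q" and e': "near_square W l' i' q" and ii: "i < i'"
  shows "l + q \<le> l'"
proof (rule ccontr)
  assume "\<not> l + q \<le> l'"
  then have less: "l' < l + q" by simp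
  have iq: "i < l + q" by (rule near_square_gap_less[OF sf q e])
  \<comment> \<open>At such \<open>t\<close> the first near square shifts by \<open>q + 1\<close>
    and the second by \<open>q\<close>, so the letters at \<open>t + q\<close> and
    \<open>t + q + 1\<close> agree: a square of half-length 1.\<close>
  have clash: False if t: "i \<le> t" "t < l + q" "l' \<le> t" "t < i'" for t
  proof -
    have "Suc t < t + (Suc q - q)"
      by (rule common_run_short[OF sf, of q "Suc q"])
        (use e e' t in \<open>auto simp: near_square_def le_Suc_eq less_Suc_eq\<close>)
    then show False by simp
  qed
  have "i' \<le> max i l'"
    using clash[of "max i l'"] less iq by (meson max.cobounded1 max.cobounded2 max_less_iff_conj not_le)
  then have l': "l' = i'" using ii e' by (auto simp: near_square_def)
  \<comment> \<open>With \<open>l' = i'\<close> the second near square shifts by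
    \<open>q + 1\<close> throughout, and it continues the shift-\<open>(q + 1)\<close> run that the
    first one starts at \<open>i\<close>.\<close>
  have "square_at W i (q + 1)"
    unfolding square_at_def
  proof (intro conjI allI impI)
    show "0 < q + 1" by simp
    show "i + 2 * (q + 1) \<le> length W" using e' l' ii by (auto simp: near_square_def)
    fix t assume "i \<le> t \<and> t < i + (q + 1)"
    then consider "i \<le> t" "t < l + q" | "i' \<le> t" "t < l' + q"
      using less l' ii by fastforce
    then show "W ! t = W ! (t + (q + 1))"
      using e e' by cases (auto simp: near_square_def)
  qed
  then show False using sf square_free_iff_square_at by blast
qed

text \<open>The overlap is cut at the two gaps; on each of the at most three pieces both shifts are
  constant and differ by at most \<^term>\<open>q' - q + 1\<close>. The shifts could coincide if
  \<^term>\<open>q' = q + 1\<close>, which is why this case is excluded.\<close>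

lemma near_square_overlap:
  assumes sf: "square_free W" and qq: "q + 2 \<le> q'"
    and e: "near_square W l i q" and e': "near_square W l' i' q'"
  shows "min (l + q) (l' + q') \<le> max l l' + 3 * (q' - q)"
proof -
  define u where "u = max l l'"
  define v where "v = min (l + q) (l' + q')"
  \<comment> \<open>The two gaps in increasing order, clamped to \<open>[u, v]\<close>; pieces may
    be empty.\<close>
  define lo where "lo = max u (min v (min i i'))"
  define hi where "hi = max u (min v (max i i'))"
  note ns = e[unfolded near_square_def] e'[unfolded near_square_def]
  have piece: "y \<le> x + (q' - q)"
    if "u \<le> x" "y \<le> v" "y \<le> i \<or> i \<le> x" "y \<le> i' \<or> i' \<le> x" for x y
  proof -
    define d where "d = (if y \<le> i then q else q + 1)"
    define d' where "d' = (if y \<le> i' then q' else q' + 1)"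
    have "y < x + (d' - d)"
    proof (rule common_run_short[OF sf])
      show "d < d'" using qq by (auto simp: d_def d'_def)
      show "y + d' \<le> length W" using that ns by (auto simp: d'_def v_def)
      fix t assume t: "x \<le> t" "t < y"
      have range: "l \<le> t" "l' \<le> t" "t < l + q" "t < l' + q'"
        using t that(1,2) by (simp_all add: u_def v_def)
      show "W ! t = W ! (t + d)"
      proof (cases "y \<le> i")
        case True
        then show ?thesis using ns(1) range t by (simp add: d_def)
      next
        case False
        then have "i \<le> t" using that(3) t by simp
        then show ?thesis using False ns(1) range by (simp add: d_def)
      qed
      show "W ! t = W ! (t + d')"
      proof (cases "y \<le> i'")
        case True
        then show ?thesis using ns(2) range t by (simp add: d'_def)
      next
        case False
        then have "i' \<le> t" using that(4) t by simp
        then show ?thesis using False ns(2) range by (simp add: d'_def)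
      qed
    qed
    \<comment> \<open>Strictness of the run bound absorbs the 1 in
      \<open>d' - d \<le> q' - q + 1\<close>.\<close>
    then show ?thesis by (auto simp: d_def d'_def split: if_splits)
  qed
  show ?thesis
  proof (cases "u \<le> v")
    case True
    have "lo \<le> u + (q' - q)"
      by (rule piece) (use True in \<open>auto simp: lo_def\<close>)
    moreover have "hi \<le> lo + (q' - q)"
      by (rule piece) (use True in \<open>auto simp: lo_def hi_def\<close>)
    moreover have "v \<le> hi + (q' - q)"
      by (rule piece) (use True in \<open>auto simp: hi_def\<close>)
    ultimately show ?thesis by (simp add: u_def v_def)
  next
    case False
    then show ?thesis unfolding u_def v_def by linarith
  qed
qed

section \<open>Packing bounds\<close>

lemma card_separated_le:
  fixes g :: "'b \<Rightarrow> nat"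
  assumes fin: "finite E" and bound: "\<And>e. e \<in> E \<Longrightarrow> g e + c \<le> n"
    and sep: "\<And>e e'. e \<in> E \<Longrightarrow> e' \<in> E \<Longrightarrow> e \<noteq> e' \<Longrightarrow> g e + c \<le> g e' \<or> g e' + c \<le> g e"
  shows "card E * c \<le> n"
proof -
  have "card (\<Union>e\<in>E. {g e..<g e + c}) = (\<Sum>e\<in>E. card {g e..<g e + c})"
    by (rule card_UN_disjoint) (use fin sep in \<open>fastforce+\<close>)
  also have "\<dots> = card E * c" by simp
  finally have "card E * c = card (\<Union>e\<in>E. {g e..<g e + c})" by simp
  also have "\<dots> \<le> card {..<n}"
    by (rule card_mono) (use bound in \<open>fastforce+\<close>)
  finally show ?thesis by simp
qed

text \<open>The start \<open>l\<close> is forgotten because the inserted letter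
  \<open>W ! (i + q)\<close> depends only on gap and half-length.\<close>

definition near_gaps :: "'a list \<Rightarrow> nat \<Rightarrow> nat set" where
  "near_gaps W q = {i. \<exists>l. near_square W l i q}"

lemma near_gaps_subset: "near_gaps W q \<subseteq> {..length W}"
  by (auto simp: near_gaps_def near_square_def)

lemma finite_near_gaps [simp]: "finite (near_gaps W q)"
  using near_gaps_subset finite_subset by blast

lemma card_near_gaps_le:
  assumes sf: "square_free W" and q: "0 < q"
  shows "card (near_gaps W q) * q \<le> length W"
proof -
  define g where "g i = (SOME l. near_square W l i q)" for i
  have g: "near_square W (g i) i q" if "i \<in> near_gaps W q" for i
    using that unfolding near_gaps_def g_def by (auto intro: someI_ex)
  show ?thesis
  proof (rule card_separated_le[where g = g])
    show "g i + q \<le> length W" if "i \<in> near_gaps W q" for i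
      using g[OF that] by (auto simp: near_square_def)
    show "g i + q \<le> g i' \<or> g i' + q \<le> g i"
      if "i \<in> near_gaps W q" "i' \<in> near_gaps W q" "i \<noteq> i'" for i i'
      using near_square_same_length_disjoint[OF sf q] g that by (metis nat_neq_iff)
  qed simp
qed

text \<open>Distinct values of equal parity differ by at least 2, as the overlap bound requires. All
  intervals of the class can therefore be packed together once cut to length
  \<open>Q - 3 * s\<close>.\<close>

lemma sum_card_near_gaps_class_le:
  assumes sf: "square_free W" and s: "0 < s" and Q: "4 * s \<le> Q"
    and A: "A \<subseteq> {Q..<Q + s}" and parity: "\<And>q q'. q \<in> A \<Longrightarrow> q' \<in> A \<Longrightarrow> even q = even q'"
  shows "(\<Sum>q\<in>A. card (near_gaps W q)) * (Q - 3 * s) \<le> length W"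
proof -
  define g where "g = (\<lambda>(q, i). SOME l. near_square W l i q)"
  let ?E = "Sigma A (near_gaps W)"
  have g: "near_square W (g (q, i)) i q" if "i \<in> near_gaps W q" for q i
    using that unfolding near_gaps_def g_def by (auto intro: someI_ex)
  have finA: "finite A" using A finite_subset by blast
  have far: "g (q, i) + (Q - 3 * s) \<le> g (q', i') \<or> g (q', i') + (Q - 3 * s) \<le> g (q, i)"
    if "(q, i) \<in> ?E" "(q', i') \<in> ?E" "(q, i) \<noteq> (q', i')" "q \<le> q'" for q i q' i'
  proof -
    have e: "near_square W (g (q, i)) i q" "near_square W (g (q', i')) i' q'"
      using g that by auto
    have q: "Q \<le> q" "q' < Q + s" "even q = even q'" using A parity that by auto
    show ?thesis
    proof (cases "q = q'")
      case True
      then have "i \<noteq> i'" "0 < q" using that q s Q by auto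
      then have "g (q, i) + q \<le> g (q', i') \<or> g (q', i') + q \<le> g (q, i)"
        using near_square_same_length_disjoint[OF sf \<open>0 < q\<close>] e True by (metis nat_neq_iff)
      then show ?thesis using q by linarith
    next
      case False
      with q \<open>q \<le> q'\<close> have "q + 2 \<le> q'" by presburger
      \<comment> \<open>Since \<open>q' - q < s\<close>, the overlap is below \<open>3 * s\<close>.
        Both intervals have length at least \<open>4 * s\<close>, so neither contains the
        other.\<close>
      from near_square_overlap[OF sf this e] q Q \<open>q \<le> q'\<close> s show ?thesis
        by (auto simp: min_def max_def split: if_splits)
    qed
  qed
  have "card ?E * (Q - 3 * s) \<le> length W"
  proof (rule card_separated_le[where g = g])
    show "finite ?E" using finA by auto
    show "g e + (Q - 3 * s) \<le> length W" if "e \<in> ?E" for e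
    proof -
      obtain q i where "e = (q, i)" "q \<in> A" "i \<in> near_gaps W q" using \<open>e \<in> ?E\<close> by auto
      with g[of i q] A show ?thesis by (fastforce simp: near_square_def)
    qed
    show "g e + (Q - 3 * s) \<le> g e' \<or> g e' + (Q - 3 * s) \<le> g e"
      if "e \<in> ?E" "e' \<in> ?E" "e \<noteq> e'" for e e'
      using far[of "fst e" "snd e" "fst e'" "snd e'"] far[of "fst e'" "snd e'" "fst e" "snd e"] that
      by (metis nle_le prod.collapse)
  qed
  then show ?thesis using finA by (simp add: card_SigmaI)
qed

lemma sum_card_near_gaps_window_le:
  assumes sf: "square_free W" and s: "0 < s" and Q: "4 * s \<le> Q"
  shows "(\<Sum>q=Q..<Q + s. card (near_gaps W q)) * (Q - 3 * s) \<le> 2 * length W"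
proof -
  let ?f = "\<lambda>q. card (near_gaps W q)"
  let ?A = "{q \<in> {Q..<Q + s}. even q}" and ?B = "{q \<in> {Q..<Q + s}. odd q}"
  have "sum ?f {Q..<Q + s} = sum ?f (?A \<union> ?B)" by (rule sum.cong) auto
  also have "\<dots> = sum ?f ?A + sum ?f ?B" by (rule sum.union_disjoint) auto
  finally have "sum ?f {Q..<Q + s} = sum ?f ?A + sum ?f ?B" .
  moreover have "sum ?f ?A * (Q - 3 * s) \<le> length W"
    by (rule sum_card_near_gaps_class_le[OF sf s Q]) blast+
  moreover have "sum ?f ?B * (Q - 3 * s) \<le> length W"
    by (rule sum_card_near_gaps_class_le[OF sf s Q]) blast+
  ultimately show ?thesis by (simp only: add_mult_distrib)
qed

section \<open>Summation over all half-lengths\<close>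

text \<open>The window at \<open>Q = (4 + r) * s\<close> has \<open>Q - 3 * s = (1 + r) * s\<close>,
  and 2 (1 + 1/2 + 1/3 + 1/4) = 25/6.\<close>

lemma sum_card_near_gaps_block_le:
  assumes sf: "square_free W" and s: "0 < s"
  shows "real (\<Sum>q=4*s..<8*s. card (near_gaps W q)) \<le> 25 / 6 * length W / s"
proof -
  let ?f = "\<lambda>q. card (near_gaps W q)"
  have win: "real (\<Sum>q=(4+r)*s..<(5+r)*s. ?f q) \<le> 2 / (1 + r) * length W / s" for r :: nat
  proof -
    have "(\<Sum>q=(4+r)*s..<(5+r)*s. ?f q) * ((1 + r) * s) \<le> 2 * length W"
      using sum_card_near_gaps_window_le[OF sf s, of "(4 + r) * s"]
      by (simp add: algebra_simps)
    then have "real (\<Sum>q=(4+r)*s..<(5+r)*s. ?f q) * ((1 + r) * s) \<le> 2 * length W"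
      by (metis of_nat_le_iff of_nat_mult of_nat_numeral)
    then have "real (\<Sum>q=(4+r)*s..<(5+r)*s. ?f q) \<le> 2 * length W / ((1 + r) * s)"
      using s by (subst pos_le_divide_eq) (auto simp: add_pos_nonneg)
    then show ?thesis by (simp add: distrib_right)
  qed
  have "sum ?f {4*s..<8*s} = sum ?f {4*s..<5*s} + sum ?f {5*s..<6*s}
      + sum ?f {6*s..<7*s} + sum ?f {7*s..<8*s}"
    by (simp add: sum.atLeastLessThan_concat)
  then show ?thesis using win[of 0] win[of 1] win[of 2] win[of 3] by simp
qed

text \<open>Blocks with s = 2, 4, ..., \<open>2^j\<close> tile the range; their bounds form a
  geometric series.\<close>

lemma sum_card_near_gaps_dyadic_le:
  assumes sf: "square_free W"
  shows "real (\<Sum>q=8..<8 * 2^j. card (near_gaps W q)) \<le> 25 / 6 * length W * (1 - 1 / 2^j)"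
proof (induction j)
  case (Suc j)
  have "(\<Sum>q=8..<8 * 2^Suc j. card (near_gaps W q)) =
      (\<Sum>q=8..<8 * 2^j. card (near_gaps W q)) + (\<Sum>q=4*2^Suc j..<8*2^Suc j. card (near_gaps W q))"
    by (simp add: sum.atLeastLessThan_concat)
  then show ?case
    using Suc sum_card_near_gaps_block_le[OF sf, of "2 ^ Suc j"] by (simp add: field_simps)
qed simp

lemma sum_card_near_gaps_less:
  assumes sf: "square_free W"
  shows "2 * (\<Sum>q\<le>length W. card (near_gaps W q)) < 17 * (length W + 1)"
proof -
  let ?f = "\<lambda>q. card (near_gaps W q)"
  let ?n = "length W"
  \<comment> \<open>This cutoff makes the dyadic blocks reach every
    \<open>q \<le> ?n\<close>.\<close>
  have "?n < 8 * 2 ^ ?n" using less_exp[of ?n] by linarith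
  then have "sum ?f {..?n} \<le> sum ?f {..<8 * 2 ^ ?n}"
    by (intro sum_mono2) auto
  also have "\<dots> = sum ?f {..<8} + sum ?f {8..<8 * 2 ^ ?n}"
    by (simp add: lessThan_atLeast0 sum.atLeastLessThan_concat)
  also have "sum ?f {..<8} = ?f 0 + ?f 1 + ?f 2 + ?f 3 + ?f 4 + ?f 5 + ?f 6 + ?f 7"
    by (simp add: eval_nat_numeral)
  finally have "real (sum ?f {..?n}) \<le> ?f 0 + ?f 1 + ?f 2 + ?f 3 + ?f 4 + ?f 5 + ?f 6 + ?f 7
      + real (sum ?f {8..<8 * 2 ^ ?n})"
    by linarith
  moreover have "real (sum ?f {8..<8 * 2 ^ ?n}) \<le> 25 / 6 * ?n"
  proof -
    have "25 / 6 * real ?n * (1 - 1 / 2 ^ ?n) \<le> 25 / 6 * real ?n * 1"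
      by (intro mult_left_mono) auto
    then show ?thesis using sum_card_near_gaps_dyadic_le[OF sf, of ?n] by linarith
  qed
  \<comment> \<open>For \<open>q = 0\<close> the intervals are empty and packing says nothing, so
    all gaps are counted.\<close>
  moreover have "?f 0 \<le> ?n + 1"
    using card_mono[OF _ near_gaps_subset, of W 0] by simp
  moreover note card_near_gaps_le[OF sf, of 1] card_near_gaps_le[OF sf, of 2]
    card_near_gaps_le[OF sf, of 3] card_near_gaps_le[OF sf, of 4] card_near_gaps_le[OF sf, of 5]
    card_near_gaps_le[OF sf, of 6] card_near_gaps_le[OF sf, of 7]
  \<comment> \<open>The coefficient of \<open>?n\<close> is 1 + (1 + 1/2 + ... + 1/7) + 25/6 < 7.8,
    below 17/2.\<close>
  ultimately have "2 * real (sum ?f {..?n}) < 17 * (real ?n + 1)"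
    by simp
  then have "real (2 * sum ?f {..?n}) < real (17 * (?n + 1))" by simp
  then show ?thesis by linarith
qed

section \<open>Double counting over gaps and half-lengths\<close>

theorem theorem1p3:
  fixes k :: nat and \<Sigma> :: "'a set"
  assumes "k \<ge> 17" and "finite \<Sigma>" and "card \<Sigma> = k"
  shows "\<not> (\<exists>W. extremal_square_free \<Sigma> W)"
proof
  assume "\<exists>W. extremal_square_free \<Sigma> W"
  then obtain W where sf: "square_free W"
    and ext: "\<And>V. V \<in> extensions \<Sigma> W \<Longrightarrow> \<not> square_free V"
    by (auto simp: extremal_square_free_def)
  let ?n = "length W"
  define R where "R U i = {q. q \<le> ?n \<and> i \<in> near_gaps U q}" for U :: "'a list" and i
  have finR [simp]: "finite (R U i)" for U i by (simp add: R_def)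
  have in_R: "q \<in> R U i" if "near_square U l i q" "length U = ?n" for U l i q
    using that by (auto simp: R_def near_gaps_def near_square_def)
  have gap: "17 \<le> card (R W i) + card (R (rev W) (?n - i))" if i: "i \<le> ?n" for i
  proof -
    \<comment> \<open>Each side and \<open>q\<close> determine one letter, so covering the alphabet
      takes at least 17 pairs of side and \<open>q\<close>.\<close>
    have "\<Sigma> \<subseteq> (\<lambda>q. W ! (i + q)) ` R W i \<union> (\<lambda>q. rev W ! (?n - i + q)) ` R (rev W) (?n - i)"
    proof
      fix x assume "x \<in> \<Sigma>"
      then have "take i W @ [x] @ drop i W \<in> extensions \<Sigma> W"
        unfolding extensions_def using append_take_drop_id[of i W, symmetric] by blast
      then have "\<not> square_free (take i W @ [x] @ drop i W)" by (rule ext)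
      from not_square_free_insertion[OF sf i this]
      show "x \<in> (\<lambda>q. W ! (i + q)) ` R W i \<union> (\<lambda>q. rev W ! (?n - i + q)) ` R (rev W) (?n - i)"
        using in_R[of W] in_R[of "rev W"] by fastforce
    qed
    then have "card \<Sigma> \<le> card ((\<lambda>q. W ! (i + q)) ` R W i \<union> (\<lambda>q. rev W ! (?n - i + q)) ` R (rev W) (?n - i))"
      by (rule card_mono[rotated]) simp
    also have "\<dots> \<le> card (R W i) + card (R (rev W) (?n - i))"
      by (intro order.trans[OF card_Un_le] add_mono card_image_le) auto
    finally show ?thesis using assms by simp
  qed
  have double: "(\<Sum>i\<le>?n. card (R U i)) = (\<Sum>q\<le>?n. card (near_gaps U q))"
    if "length U = ?n" for U
  proof -
    have "R U i = {..?n} \<inter> {q. i \<in> near_gaps U q}" for i by (auto simp: R_def)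
    then have "(\<Sum>i\<le>?n. card (R U i)) = (\<Sum>i\<le>?n. \<Sum>q\<le>?n. if i \<in> near_gaps U q then 1 else 0)"
      by (simp add: sum.If_cases)
    also have "\<dots> = (\<Sum>q\<le>?n. \<Sum>i\<le>?n. if i \<in> near_gaps U q then 1 else 0)"
      by (rule sum.swap)
    also have "\<dots> = (\<Sum>q\<le>?n. card (near_gaps U q))"
      using near_gaps_subset[of U] that by (simp add: sum.If_cases Int_absorb1)
    finally show ?thesis .
  qed
  have "17 * (?n + 1) = (\<Sum>i\<le>?n. 17)" by simp
  also have "\<dots> \<le> (\<Sum>i\<le>?n. card (R W i) + card (R (rev W) (?n - i)))"
    by (intro sum_mono gap) simp
  \<comment> \<open>The reflection \<open>i \<mapsto> ?n - i\<close> permutes the gaps, so the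
    reversed word is summed over all its gaps.\<close>
  also have "\<dots> = (\<Sum>i\<le>?n. card (R W i)) + (\<Sum>i\<le>?n. card (R (rev W) i))"
    unfolding sum.distrib
    by (intro arg_cong2[of _ _ _ _ "(+)"] refl
        sum.reindex_bij_witness[of _ "\<lambda>i. ?n - i" "\<lambda>i. ?n - i"]) auto
  also have "\<dots> = (\<Sum>q\<le>?n. card (near_gaps W q)) + (\<Sum>q\<le>?n. card (near_gaps (rev W) q))"
    by (simp add: double)
  finally show False
    using sum_card_near_gaps_less[OF sf] sum_card_near_gaps_less[OF square_free_rev[OF sf]] by simp
qed

end
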